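(* Consider the small-data-arrival-energy-limited regime: $\overline{\lambda}$ and $\overline{\alpha}$ are sufficiently small and $E_1(1/\overline{\alpha})<\overline{\lambda}<\exp(1/x)E_1(1/x)$, where $x>0$ satisfies $x\exp(-1/x)-E_1(1/x)=\overline{\alpha}$. Let $e^{th}$ be the solution of $E_1(\tau/e^{th})=\overline{\lambda}$. Let $V(q,e)$ be the closed-form priority function of this regime: for $0<e<e^{th}$, $$V(q,e)=-\frac{e^3}{3\overline{\lambda}\,\overline{\alpha}^2\tau^2}+\frac{e^2}{2\overline{\alpha}^2\tau}-\frac{qe}{\overline{\lambda}\,\overline{\alpha}\,\tau}+C_2,\qquad C_2=\frac{\tau}{2}-\frac{\overline{\alpha}\tau}{3\overline{\lambda}},$$ and for $e\ge e^{th}$, $V(q,e)$ is a function of $q$ only. Then the power control $$p^\ast=\min\Big\{\Big(W(q,e)-\frac{1}{|h|^2}\Big)^+,\frac{e}{\tau}\Big\},\qquad W(q,e)=-\frac{\partial V(q,e)}{\partial q}\Big/\frac{\partial V(q,e)}{\partial e},$$ has the following structure: (1) When $0<e<e^{th}$ and $q>\frac{-e^2+\overline{\lambda}\tau e}{\overline{\alpha}\tau}$, $p^\ast=0$. (2) When $0<e<\sqrt{\overline{\alpha}\tau q}$ and $q<\frac{-e^2+\overline{\lambda}\tau e}{\overline{\alpha}\tau}$, the water level $W(q,e)$ is an increasing function of $q$ for given $e$, and a decreasing function of $e$ for given $q$. (3) When $\sqrt{\overline{\alpha}\tau q}<e<e^{th}$ and $q<\frac{-e^2+\overline{\lambda}\tau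 e}{\overline{\alpha}\tau}$, the water level $W(q,e)$ is an increasing function of $q$ for given $e$, and an increasing function of $e$ for given $q$. (4) When $e\ge e^{th}$, $p^\ast=e/\tau$.
   Context: Here $q\ge0$ is the data queue length, $e\in[0,N_E]$ the energy queue length ($N_E>0$ the energy storage capacity), $h\in\mathbb{C}$ the channel coefficient, $\tau>0$ the slot duration, $\overline{\lambda}>0$ the mean data arrival rate and $\overline{\alpha}>0$ the mean energy arrival rate. $E_1(x)=\int_1^\infty\frac{e^{-tx}}{t}\,\mathrm{d}t$ is the exponential integral, $y^+=\max\{y,0\}$. Convention: when $\frac{\partial V}{\partial e}=0$, the water level $W$ is taken to be $+\infty$, so that $p^\ast=e/\tau$. *)

theory Defs
  imports "HOL-Analysis.Analysis"
begin

definition E1 :: "real \<Rightarrow> real" where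
  "E1 x = integral {1..} (\<lambda>t. exp (- t * x) / t)"

(* The argument lam is the mean data arrival rate, \<alpha> the mean energy arrival rate, \<tau> the slot
   duration and eth the energy threshold. Only the fact that the priority function does not depend
   on e for e \<ge> eth is prescribed, so its values there are given by an arbitrary function g of q. *)
definition priority_fun ::
    "(real \<Rightarrow> real) \<Rightarrow> real \<Rightarrow> real \<Rightarrow> real \<Rightarrow> real \<Rightarrow> real \<Rightarrow> real \<Rightarrow> real" where
  "priority_fun g lam \<alpha> \<tau> eth q e =
     (if e < eth
      then - (e ^ 3) / (3 * lam * \<alpha>\<^sup>2 * \<tau>\<^sup>2) + e\<^sup>2 / (2 * \<alpha>\<^sup>2 * \<tau>) - q * e / (lam * \<alpha> * \<tau>)
             + (\<tau> / 2 - \<alpha> * \<tau> / (3 * lam))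
      else g q)"

definition partial_q :: "(real \<Rightarrow> real \<Rightarrow> real) \<Rightarrow> real \<Rightarrow> real \<Rightarrow> real" where
  "partial_q V q e = deriv (\<lambda>s. V s e) q"

(* The right-hand derivative. It is the ordinary partial derivative wherever that exists. It matters
   only at the junction e = eth of the two branches, where V need not be differentiable in e: the
   point e = eth belongs to the branch e \<ge> eth, on which V is constant in e. *)
definition partial_e :: "(real \<Rightarrow> real \<Rightarrow> real) \<Rightarrow> real \<Rightarrow> real \<Rightarrow> real" where
  "partial_e V q e = vector_derivative (\<lambda>s. V q s) (at_right e)"

definition water_level :: "(real \<Rightarrow> real \<Rightarrow> real) \<Rightarrow> real \<Rightarrow> real \<Rightarrow> ereal" where
  "water_level V q e =
     (if partial_e V q e = 0 then \<infinity> else ereal (- partial_q V q e / partial_e V q e))"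

(* For h = 0 the term 1 / |h|^2 is \<infinity> in ereal; since \<infinity> - \<infinity> = \<infinity> in ereal, an infinite water level
   gives power e / \<tau> for every h. *)
definition power_control ::
    "(real \<Rightarrow> real \<Rightarrow> real) \<Rightarrow> real \<Rightarrow> complex \<Rightarrow> real \<Rightarrow> real \<Rightarrow> ereal" where
  "power_control V \<tau> h q e =
     min (max (water_level V q e - 1 / ereal ((cmod h)\<^sup>2)) 0) (ereal (e / \<tau>))"

end

theory Submission
  imports Defs
begin

text \<open>For \<open>e < eth\<close> the water level is
  \<open>W = \<alpha> \<tau> / (lam \<tau> - e - \<alpha> \<tau> q / e)\<close>. The bracket is negative in case 1; it decreases in \<open>q\<close>,
  and, having \<open>e\<close>-derivative \<open>\<alpha> \<tau> q / e\<^sup>2 - 1\<close>, it increases in \<open>e\<close> below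
  \<open>sqrt (\<alpha> \<tau> q)\<close> and decreases above. Case 2 does not presuppose \<open>e < eth\<close>: there
  \<open>e < lam \<tau>\<close>, and \<open>lam \<tau> \<le> eth\<close> follows from \<open>E1 y \<le> 1 / y\<close> at \<open>y = \<tau> / eth\<close>.\<close>

text \<open>For \<open>t \<ge> 1\<close> the factor \<open>1 / t\<close> is at most 1, so the
  integrand lies below \<open>exp (- y * t)\<close>, whose integral over \<open>{1..}\<close> is
  \<open>exp (- y) / y\<close>.\<close>

lemma E1_le:
  assumes "0 < y"
  shows "E1 y \<le> 1 / y"
proof (cases "(\<lambda>t. exp (- t * y) / t) integrable_on {1..}")
  case True
  have exp_int: "((\<lambda>t. exp (- y * t)) has_integral exp (- y * 1) / y) {1..}"
    using assms by (rule has_integral_exp_minus_to_infinity)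
  have "E1 y \<le> exp (- y * 1) / y"
    unfolding E1_def
  proof (rule has_integral_le[OF integrable_integral[OF True] exp_int])
    fix t :: real assume "t \<in> {1..}"
    then show "exp (- t * y) / t \<le> exp (- y * t)"
      by (simp add: divide_le_eq mult.commute)
  qed
  also have "\<dots> \<le> 1 / y"
    using assms by (simp add: divide_right_mono)
  finally show ?thesis .
next
  \<comment> \<open>Here the integral takes its default value 0, so the bound is immediate; the case
    split spares a proof of integrability.\<close>
  case False
  then show ?thesis
    using assms by (simp add: E1_def not_integrable_integral)
qed

lemma partial_q_priority_fun:
  assumes "e < eth" and "lam \<noteq> 0" and "\<alpha> \<noteq> 0" and "\<tau> \<noteq> 0"
  shows "partial_q (priority_fun g lam \<alpha> \<tau> eth) q e = - e / (lam * \<alpha> * \<tau>)"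
  unfolding partial_q_def priority_fun_def using assms
  by (auto intro!: DERIV_imp_deriv derivative_eq_intros)

lemma partial_e_priority_fun:
  assumes "e < eth" and "lam \<noteq> 0" and "\<alpha> \<noteq> 0" and "\<tau> \<noteq> 0"
  shows "partial_e (priority_fun g lam \<alpha> \<tau> eth) q e =
    (- e\<^sup>2 + lam * \<tau> * e - \<alpha> * \<tau> * q) / (lam * \<alpha>\<^sup>2 * \<tau>\<^sup>2)"
proof -
  have "((\<lambda>s. - (s ^ 3) / (3 * lam * \<alpha>\<^sup>2 * \<tau>\<^sup>2) + s\<^sup>2 / (2 * \<alpha>\<^sup>2 * \<tau>) - q * s / (lam * \<alpha> * \<tau>)
      + (\<tau> / 2 - \<alpha> * \<tau> / (3 * lam))) has_field_derivative
      (- e\<^sup>2 + lam * \<tau> * e - \<alpha> * \<tau> * q) / (lam * \<alpha>\<^sup>2 * \<tau>\<^sup>2)) (at e)"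
    using assms
    by (auto intro!: derivative_eq_intros simp: field_simps power2_eq_square)
  then have "((\<lambda>s. priority_fun g lam \<alpha> \<tau> eth q s) has_field_derivative
      (- e\<^sup>2 + lam * \<tau> * e - \<alpha> * \<tau> * q) / (lam * \<alpha>\<^sup>2 * \<tau>\<^sup>2)) (at e)"
    \<comment> \<open>As \<open>e < eth\<close> is strict, the polynomial branch holds on an open
      neighbourhood of \<open>e\<close>; the two-sided derivative then restricts to the right-hand
      one.\<close>
    by (rule has_field_derivative_transform_within_open[where S = "{..<eth}"])
      (use assms in \<open>auto simp: priority_fun_def\<close>)
  then have "((\<lambda>s. priority_fun g lam \<alpha> \<tau> eth q s) has_vector_derivative
      (- e\<^sup>2 + lam * \<tau> * e - \<alpha> * \<tau> * q) / (lam * \<alpha>\<^sup>2 * \<tau>\<^sup>2)) (at_right e)"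
    by (simp add: has_real_derivative_iff_has_vector_derivative has_vector_derivative_at_within)
  then show ?thesis
    unfolding partial_e_def
    by (intro vector_derivative_within) (simp_all add: trivial_limit_at_right_real)
qed

text \<open>Only arguments in \<open>{e..}\<close> matter for a right-hand derivative, and there the
  constant branch holds. This covers \<open>e = eth\<close>, where the two branches may not
  meet.\<close>

lemma partial_e_priority_fun_eq_0:
  assumes "eth \<le> e"
  shows "partial_e (priority_fun g lam \<alpha> \<tau> eth) q e = 0"
proof -
  have "((\<lambda>s. g q) has_vector_derivative 0) (at e within {e..})"
    by simp
  then have "((\<lambda>s. priority_fun g lam \<alpha> \<tau> eth q s) has_vector_derivative 0) (at e within {e..})"
    by (rule has_vector_derivative_transform[rotated -1])
      (use assms in \<open>auto simp: priority_fun_def\<close>)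
  then have "((\<lambda>s. priority_fun g lam \<alpha> \<tau> eth q s) has_vector_derivative 0) (at_right e)"
    by (rule has_vector_derivative_within_subset) auto
  then show ?thesis
    unfolding partial_e_def
    by (intro vector_derivative_within) (simp_all add: trivial_limit_at_right_real)
qed

text \<open>The hypothesis on \<open>q\<close> says that \<open>partial_e\<close> is nonzero, so the
  water level is finite. Dividing through by \<open>e\<close> leaves a constant numerator:
  \<open>q\<close> and \<open>e\<close> enter only through the denominator, as
  \<open>e + \<alpha> * \<tau> * q / e\<close>.\<close>

lemma water_level_priority_fun:
  assumes "0 < e" "e < eth" "0 < lam" "0 < \<alpha>" "0 < \<tau>"
    and "q \<noteq> (- e\<^sup>2 + lam * \<tau> * e) / (\<alpha> * \<tau>)"
  shows "water_level (priority_fun g lam \<alpha> \<tau> eth) q e =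
    ereal (\<alpha> * \<tau> / (lam * \<tau> - e - \<alpha> * \<tau> * q / e))"
proof -
  let ?D = "- e\<^sup>2 + lam * \<tau> * e - \<alpha> * \<tau> * q"
  have nz: "?D \<noteq> 0"
    using assms by (simp add: field_simps)
  have eq: "lam * \<tau> - e - \<alpha> * \<tau> * q / e = ?D / e"
    using assms by (simp add: field_simps power2_eq_square)
  have "- (- e / (lam * \<alpha> * \<tau>)) / (?D / (lam * \<alpha>\<^sup>2 * \<tau>\<^sup>2)) = \<alpha> * \<tau> / (?D / e)"
    using assms nz by (simp add: power2_eq_square)
  then show ?thesis
    unfolding water_level_def using assms nz
    by (simp add: partial_e_priority_fun partial_q_priority_fun eq)
qed

lemma power_control_eq_0:
  assumes "water_level V q e = ereal w" "w \<le> 0" "0 \<le> e / \<tau>"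
  shows "power_control V \<tau> h q e = 0"
proof -
  have "ereal w - 1 / ereal ((cmod h)\<^sup>2) \<le> 0"
  proof (cases "h = 0")
    \<comment> \<open>The inverse of 0 is \<infinity> in \<open>ereal\<close>, so the difference is
      - \<infinity>.\<close>
    case True
    then show ?thesis
      by (simp add: divide_ereal_def)
  next
    case False
    have "w \<le> 1 / (cmod h)\<^sup>2"
      using assms(2) by (rule order_trans) simp
    with False show ?thesis
      by (simp add: one_ereal_def)
  qed
  then show ?thesis
    unfolding power_control_def assms(1) using assms(3)
    by (simp add: max_absorb2 min_absorb1)
qed

lemma power_control_eq_full:
  assumes "partial_e V q e = 0"
  shows "power_control V \<tau> h q e = ereal (e / \<tau>)"
  using assms unfolding power_control_def water_level_def
  by (simp add: min_absorb2)

text \<open>The difference of the two sides factors as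
  \<open>(s - r) * (c - r * s) / (r * s)\<close>, and both points lie below \<open>sqrt c\<close>,
  so \<open>r * s < c\<close>. With \<open>c = \<alpha> * \<tau> * q\<close> this gives the
  dependence on \<open>e\<close> in case 2.\<close>

lemma add_div_less_below_sqrt:
  fixes c :: real
  assumes "0 < r" "r < s" "s < sqrt c"
  shows "s + c / s < r + c / r"
proof -
  \<comment> \<open>Since \<open>sqrt\<close> is odd on the reals, this also yields
    \<open>0 < c\<close>, whence \<open>sqrt c * sqrt c = c\<close>.\<close>
  have "0 < sqrt c"
    using assms by linarith
  have "r * s < c"
  proof -
    have "r * s < s * s"
      using assms by simp
    also have "\<dots> < sqrt c * sqrt c"
      using assms by (intro mult_strict_mono) (use assms \<open>0 < sqrt c\<close> in linarith)+
    also have "\<dots> = c"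
      using \<open>0 < sqrt c\<close> by simp
    finally show ?thesis .
  qed
  then have "0 < (s - r) * (c - r * s) / (r * s)"
    using assms by simp
  also have "\<dots> = (r + c / r) - (s + c / s)"
    using assms by (simp add: field_simps)
  finally show ?thesis
    by simp
qed

text \<open>The same factorization with the sign reversed, as now \<open>c < r * s\<close>; it
  serves case 3. The value \<open>c = 0\<close> must be allowed because \<open>q\<close> may be
  0.\<close>

lemma add_div_less_above_sqrt:
  fixes c :: real
  assumes "0 \<le> c" "sqrt c < r" "r < s"
  shows "r + c / r < s + c / s"
proof -
  have "0 < r"
    using assms by (meson le_less_trans real_sqrt_ge_zero)
  have "c < r * s"
  proof -
    have "c = sqrt c * sqrt c"
      using assms by simp
    also have "\<dots> < r * s"
      using assms \<open>0 < r\<close> by (intro mult_strict_mono) auto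
    finally show ?thesis .
  qed
  then have "0 < (s - r) * (r * s - c) / (r * s)"
    using assms \<open>0 < r\<close> by simp
  also have "\<dots> = (s + c / s) - (r + c / r)"
    using assms \<open>0 < r\<close> by (simp add: field_simps)
  finally show ?thesis
    by simp
qed

text \<open>Scaling by the positive number \<open>\<alpha> * \<tau> / e\<close> turns the position
  of \<open>q\<close> relative to the frontier into the sign of the denominator of the water
  level.\<close>

lemma less_frontier_iff:
  fixes e :: real
  assumes "0 < e" "0 < \<alpha>" "0 < \<tau>"
  shows "q < (- e\<^sup>2 + lam * \<tau> * e) / (\<alpha> * \<tau>) \<longleftrightarrow> 0 < lam * \<tau> - e - \<alpha> * \<tau> * q / e"
    and "(- e\<^sup>2 + lam * \<tau> * e) / (\<alpha> * \<tau>) < q \<longleftrightarrow> lam * \<tau> - e - \<alpha> * \<tau> * q / e < 0"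
  using assms by (simp_all add: field_simps power2_eq_square)

theorem corollary3:
  shows "\<exists>\<delta>>0. \<forall>(lam::real) (\<alpha>::real) (x::real) (\<tau>::real) (N\<^sub>E::real) (eth::real) (g::real \<Rightarrow> real).
    0 < lam \<and> lam < \<delta> \<and> 0 < \<alpha> \<and> \<alpha> < \<delta> \<and> 0 < \<tau> \<and> 0 < N\<^sub>E \<and>
    0 < x \<and> x * exp (- 1 / x) - E1 (1 / x) = \<alpha> \<and>
    E1 (1 / \<alpha>) < lam \<and> lam < exp (1 / x) * E1 (1 / x) \<and>
    0 < eth \<and> E1 (\<tau> / eth) = lam \<longrightarrow>
    (let V = priority_fun g lam \<alpha> \<tau> eth;
         W = water_level V;
         p = power_control V \<tau>
     in
      (\<forall>q e h. 0 \<le> q \<and> e \<le> N\<^sub>E \<and> 0 < e \<and> e < eth \<and>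
          q > (- e\<^sup>2 + lam * \<tau> * e) / (\<alpha> * \<tau>) \<longrightarrow> p h q e = 0) \<and>
      (\<forall>e. strict_mono_on {q. 0 \<le> q \<and> e \<le> N\<^sub>E \<and> 0 < e \<and> e < sqrt (\<alpha> * \<tau> * q) \<and>
          q < (- e\<^sup>2 + lam * \<tau> * e) / (\<alpha> * \<tau>)} (\<lambda>q. W q e)) \<and>
      (\<forall>q. strict_antimono_on {e. 0 \<le> q \<and> e \<le> N\<^sub>E \<and> 0 < e \<and> e < sqrt (\<alpha> * \<tau> * q) \<and>
          q < (- e\<^sup>2 + lam * \<tau> * e) / (\<alpha> * \<tau>)} (\<lambda>e. W q e)) \<and>
      (\<forall>e. strict_mono_on {q. 0 \<le> q \<and> e \<le> N\<^sub>E \<and> sqrt (\<alpha> * \<tau> * q) < e \<and> e < eth \<and>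
          q < (- e\<^sup>2 + lam * \<tau> * e) / (\<alpha> * \<tau>)} (\<lambda>q. W q e)) \<and>
      (\<forall>q. strict_mono_on {e. 0 \<le> q \<and> e \<le> N\<^sub>E \<and> sqrt (\<alpha> * \<tau> * q) < e \<and> e < eth \<and>
          q < (- e\<^sup>2 + lam * \<tau> * e) / (\<alpha> * \<tau>)} (\<lambda>e. W q e)) \<and>
      (\<forall>q e h. 0 \<le> q \<and> e \<le> N\<^sub>E \<and> eth \<le> e \<longrightarrow> p h q e = ereal (e / \<tau>)))"
proof (rule exI[of _ 1], intro conjI allI impI, goal_cases)
  case 1
  show ?case by simp
next
  case (2 lam \<alpha> x \<tau> N\<^sub>E eth g)
  then have pos: "0 < lam" "0 < \<alpha>" "0 < \<tau>" "0 < eth" and eth: "E1 (\<tau> / eth) = lam"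
    by auto
  have lam_le: "lam * \<tau> \<le> eth"
    using E1_le[of "\<tau> / eth"] pos eth by (simp add: field_simps)
  define V where "V = priority_fun g lam \<alpha> \<tau> eth"
  define D where "D q e = lam * \<tau> - e - \<alpha> * \<tau> * q / e" for q e
  note below = less_frontier_iff(1)[where lam = lam, OF _ pos(2,3), folded D_def]
  note above = less_frontier_iff(2)[where lam = lam, OF _ pos(2,3), folded D_def]
  have W: "water_level V q e = ereal (\<alpha> * \<tau> / D q e)"
    if "0 < e" "e < eth" "q \<noteq> (- e\<^sup>2 + lam * \<tau> * e) / (\<alpha> * \<tau>)" for q e
    unfolding V_def D_def using that pos by (intro water_level_priority_fun)
  \<comment> \<open>Below the frontier \<open>D\<close> is positive, so comparing water levels
    amounts to comparing \<open>D\<close> in the reverse order; all four monotonicity claims reduce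
    to this.\<close>
  have W_less: "water_level V q e < water_level V q' e'"
    if "0 < e" "e < eth" "q < (- e\<^sup>2 + lam * \<tau> * e) / (\<alpha> * \<tau>)"
      and "0 < e'" "e' < eth" "q' < (- e'\<^sup>2 + lam * \<tau> * e') / (\<alpha> * \<tau>)"
      and "D q' e' < D q e" for q e q' e'
    using that pos below[of e q] below[of e' q']
    by (simp add: W divide_strict_left_mono)
  \<comment> \<open>Positivity of \<open>D\<close> gives \<open>e < lam * \<tau>\<close>, because
    the subtracted term \<open>\<alpha> * \<tau> * q / e\<close> is nonnegative.\<close>
  have less_eth: "e < eth"
    if "0 < e" "0 \<le> q" "q < (- e\<^sup>2 + lam * \<tau> * e) / (\<alpha> * \<tau>)" for q e
  proof -
    have "0 < D q e" "0 \<le> \<alpha> * \<tau> * q / e"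
      using that pos below[of e q] by simp_all
    then show ?thesis
      unfolding D_def using lam_le by linarith
  qed
  have D_q: "D q' e < D q e" if "q < q'" "0 < e" for q q' e
    using that pos by (simp add: D_def divide_strict_right_mono)
  \<comment> \<open>The region of case 3 bounds \<open>e\<close> from below only by the square root,
    so positivity has to be derived.\<close>
  have gt_0: "0 < e" if "0 \<le> q" "sqrt (\<alpha> * \<tau> * q) < e" for q e
    using that pos by (meson le_less_trans real_sqrt_ge_zero mult_nonneg_nonneg less_imp_le)
  show ?case
    unfolding Let_def V_def[symmetric]
  proof (intro conjI allI impI)
    fix q e :: real and h
    assume *: "0 \<le> q \<and> e \<le> N\<^sub>E \<and> 0 < e \<and> e < eth \<and> (- e\<^sup>2 + lam * \<tau> * e) / (\<alpha> * \<tau>) < q"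
    \<comment> \<open>Above the frontier \<open>D\<close> is negative, so the water level is finite
      and not positive, and the positive part in the power vanishes.\<close>
    have "\<alpha> * \<tau> / D q e \<le> 0"
      using * pos above[of e q] by (simp add: divide_nonneg_neg)
    then show "power_control V \<tau> h q e = 0"
      using * pos by (intro power_control_eq_0[OF W]) auto
  next
    fix e :: real
    show "strict_mono_on {q. 0 \<le> q \<and> e \<le> N\<^sub>E \<and> 0 < e \<and> e < sqrt (\<alpha> * \<tau> * q) \<and>
        q < (- e\<^sup>2 + lam * \<tau> * e) / (\<alpha> * \<tau>)} (\<lambda>q. water_level V q e)"
      by (intro strict_mono_onI W_less) (auto intro: less_eth D_q)
  next
    fix q :: real
    show "strict_antimono_on {e. 0 \<le> q \<and> e \<le> N\<^sub>E \<and> 0 < e \<and> e < sqrt (\<alpha> * \<tau> * q) \<and>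
        q < (- e\<^sup>2 + lam * \<tau> * e) / (\<alpha> * \<tau>)} (\<lambda>e. water_level V q e)"
    proof (rule monotone_onI, intro W_less)
      fix r s :: real
      assume "r \<in> {e. 0 \<le> q \<and> e \<le> N\<^sub>E \<and> 0 < e \<and> e < sqrt (\<alpha> * \<tau> * q) \<and>
          q < (- e\<^sup>2 + lam * \<tau> * e) / (\<alpha> * \<tau>)}"
        and "s \<in> {e. 0 \<le> q \<and> e \<le> N\<^sub>E \<and> 0 < e \<and> e < sqrt (\<alpha> * \<tau> * q) \<and>
          q < (- e\<^sup>2 + lam * \<tau> * e) / (\<alpha> * \<tau>)}"
        and "r < s"
      then show "D q r < D q s"
        using add_div_less_below_sqrt[of r s "\<alpha> * \<tau> * q"] by (simp add: D_def)
    qed (auto intro: less_eth)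
  next
    fix e :: real
    show "strict_mono_on {q. 0 \<le> q \<and> e \<le> N\<^sub>E \<and> sqrt (\<alpha> * \<tau> * q) < e \<and> e < eth \<and>
        q < (- e\<^sup>2 + lam * \<tau> * e) / (\<alpha> * \<tau>)} (\<lambda>q. water_level V q e)"
      by (intro strict_mono_onI W_less) (auto intro: gt_0 D_q)
  next
    fix q :: real
    show "strict_mono_on {e. 0 \<le> q \<and> e \<le> N\<^sub>E \<and> sqrt (\<alpha> * \<tau> * q) < e \<and> e < eth \<and>
        q < (- e\<^sup>2 + lam * \<tau> * e) / (\<alpha> * \<tau>)} (\<lambda>e. water_level V q e)"
    proof (intro strict_mono_onI W_less)
      fix r s :: real
      assume "r \<in> {e. 0 \<le> q \<and> e \<le> N\<^sub>E \<and> sqrt (\<alpha> * \<tau> * q) < e \<and> e < eth \<and>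
          q < (- e\<^sup>2 + lam * \<tau> * e) / (\<alpha> * \<tau>)}"
        and "r < s"
      then show "D q s < D q r"
        using pos add_div_less_above_sqrt[of "\<alpha> * \<tau> * q" r s] by (simp add: D_def)
    qed (auto intro: gt_0)
  next
    fix q e :: real and h
    assume "0 \<le> q \<and> e \<le> N\<^sub>E \<and> eth \<le> e"
    then show "power_control V \<tau> h q e = ereal (e / \<tau>)"
      by (intro power_control_eq_full) (simp add: V_def partial_e_priority_fun_eq_0)
  qed
qed

end
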